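(* Let $\mathcal{X}\subseteq\mathbb{R}^n$ and $\mathcal{U}\subseteq\mathbb{R}^m$ be boxes, let $f=f_0+f_{\mathrm{NN}}$ be the neural network control system dynamics described in the context, and let $\mathcal{S}^*$ be the maximal controlled invariant set of $x_{k+1}=f(x_k,u_k)$, $x_k\in\mathcal{X}$, $u_k\in\mathcal{U}$. For any $\varepsilon>0$ and any integer $N_u\ge1$, the subpaving $\mathbb{O}$ returned by Algorithm 3 (described in the context) with inputs $\mathcal{X},\mathcal{U},\varepsilon,N_u$ satisfies $\mathbb{O}\subseteq\mathcal{X}\setminus\mathcal{S}^*$.
   Context: A box is a Cartesian product of closed intervals $[\underline{x},\overline{x}]$ with $\underline{x}\le\overline{x}$. Its width is $w([\bm x])=\|\overline{\bm x}-\underline{\bm x}\|_\infty$. The finite collections of boxes $\mathbb{O}_k$ below are identified with the unions of their boxes; containments and equalities are between these unions. System: $f=f_0+f_{\mathrm{NN}}:\mathbb{R}^n\times\mathbb{R}^m\to\mathbb{R}^n$. Here $f_0$ is twice continuously differentiable on an open set containing $\mathcal{X}\times\mathcal{U}$ with bounded second-order partial derivatives, and $f_{\mathrm{NN}}$ is a feed-forward neural network: $z^{(0)}=(x,u)$, $z^{(i)}=\sigma(W^{(i)}z^{(i-1)}+b^{(i)})$ for $i=1,\dots,\ell-1$, $f_{\mathrm{NN}}(x,u)=W^{(\ell)}z^{(\ell-1)}+b^{(\ell)}$, with $\sigma$ an activation function (such as ReLU or $\tanh$) applied elementwise. A set $\mathcal{S}\subseteq\mathcal{X}$ is a controlled invariant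 set (CIS) if for every $x\in\mathcal{S}$ there exists $u\in\mathcal{U}$ with $f(x,u)\in\mathcal{S}$. The maximal controlled invariant set (MCIS) is $\mathcal{S}^*=\bigcup\{\mathcal{S}\subseteq\mathcal{X}:\mathcal{S}\text{ is a CIS}\}$. Inclusion function: $[f]$ maps each joint box $[\bm b]\times[\bm u]$ to a box $[f]([\bm b],[\bm u])\supseteq\{f(x,u):x\in[\bm b],u\in[\bm u]\}$. Algorithm 3 (inputs $\mathcal{X},\mathcal{U},\varepsilon,N_u$, using a fixed inclusion function $[f]$ for $f$): set $\mathbb{O}_0=\emptyset$ and partition $\mathcal{U}=\bigcup_{i=1}^{N_u}[\bm u_s^{(i)}]$ into $N_u$ boxes (control slices). For $k=0,1,2,\dots$: initialize a queue $\mathcal{Q}=\{\mathcal{X}\}$ and $\mathbb{O}_{k+1}=\mathbb{O}_k$. While $\mathcal{Q}\ne\emptyset$, pop a box $[\bm b]$. If $[f]([\bm b],[\bm u_s^{(i)}])\cap\mathcal{X}\subseteq\mathbb{O}_k$ for every $i=1,\dots,N_u$, add $[\bm b]$ to $\mathbb{O}_{k+1}$. Otherwise, if $w([\bm b])>\varepsilon$, bisect $[\bm b]$ into two boxes with disjoint interiors whose union is $[\bm b]$ and put both in $\mathcal{Q}$. Otherwise drop $[\bm b]$. When $\mathcal{Q}=\emptyset$: if $\mathbb{O}_{k+1}=\mathbb{O}_k$, stop and return $\mathbb{O}=\mathbb{O}_{k+1}$; otherwise continue with $k+1$. *)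

theory Defs
  imports "HOL-Analysis.Analysis" "HOL-Library.Multiset" "Jordan_Normal_Form.Matrix"
begin

no_notation Matrix.vec_index (infixl "$" 100)

section \<open>Boxes\<close>

definition is_box :: "(real ^ 'n) set \<Rightarrow> bool" where
  "is_box B \<longleftrightarrow> (\<exists>lo hi. (\<forall>i. lo $ i \<le> hi $ i) \<and> B = cbox lo hi)"

definition box_width :: "(real ^ 'n) set \<Rightarrow> real" where
  "box_width B = infnorm (interval_upperbound B - interval_lowerbound B)"

text \<open>Closed boxes of a partition may share boundary points; only their interiors are disjoint.\<close>

definition box_partition :: "(real ^ 'm) set \<Rightarrow> nat \<Rightarrow> (nat \<Rightarrow> (real ^ 'm) set) \<Rightarrow> bool" where
  "box_partition U N us \<longleftrightarrow>
     (\<forall>i\<in>{1..N}. is_box (us i)) \<and>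
     (\<forall>i\<in>{1..N}. \<forall>j\<in>{1..N}. i \<noteq> j \<longrightarrow> interior (us i) \<inter> interior (us j) = {}) \<and>
     (\<Union>i\<in>{1..N}. us i) = U"

definition bisects :: "(real ^ 'n) set \<Rightarrow> (real ^ 'n) set \<Rightarrow> (real ^ 'n) set \<Rightarrow> bool" where
  "bisects B B1 B2 \<longleftrightarrow>
     is_box B1 \<and> is_box B2 \<and> interior B1 \<inter> interior B2 = {} \<and> B1 \<union> B2 = B"

definition inclusion_function ::
  "((real ^ 'n) \<times> (real ^ 'm) \<Rightarrow> real ^ 'n) \<Rightarrow>
   ((real ^ 'n) set \<Rightarrow> (real ^ 'm) set \<Rightarrow> (real ^ 'n) set) \<Rightarrow> bool" where
  "inclusion_function f F \<longleftrightarrow>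
     (\<forall>B V. is_box B \<longrightarrow> is_box V \<longrightarrow> is_box (F B V) \<and> f ` (B \<times> V) \<subseteq> F B V)"


section \<open>Dynamics\<close>

text \<open>
  Here \<open>D1\<close> and \<open>D2\<close> are the first and second Frechet derivatives of \<open>g\<close> on the open set \<open>D\<close>, so
  for basis vectors \<open>i\<close> and \<open>j\<close> the vector \<open>D2 p i j\<close> consists of the second-order partial
  derivatives, in the directions \<open>i\<close> and \<open>j\<close>, of the components of \<open>g\<close> at \<open>p\<close>.
\<close>

definition C2_bounded_partials_on ::
  "'a::euclidean_space set \<Rightarrow> ('a \<Rightarrow> 'b::euclidean_space) \<Rightarrow> bool" where
  "C2_bounded_partials_on D g \<longleftrightarrow>
     (\<exists>(D1 :: 'a \<Rightarrow> 'a \<Rightarrow>\<^sub>L 'b) (D2 :: 'a \<Rightarrow> 'a \<Rightarrow>\<^sub>L 'a \<Rightarrow>\<^sub>L 'b).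
        (\<forall>p\<in>D. (g has_derivative blinfun_apply (D1 p)) (at p)) \<and>
        (\<forall>p\<in>D. (D1 has_derivative blinfun_apply (D2 p)) (at p)) \<and>
        continuous_on D D2 \<and>
        (\<exists>M. \<forall>p\<in>D. \<forall>i\<in>Basis. \<forall>j\<in>Basis. \<forall>k\<in>Basis.
           \<bar>inner (blinfun_apply (blinfun_apply (D2 p) i) j) k\<bar> \<le> M))"

text \<open>
  The widths of the layers vary with the layer, hence matrices and vectors with explicit dimensions.
  The coordinates of \<open>real ^ 'n\<close> are listed in the fixed order given by \<open>from_nat_into\<close>
  and its inverse \<open>to_nat_on\<close>.
\<close>

definition list_coords :: "real ^ 'n \<Rightarrow> real Matrix.vec" where
  "list_coords x = Matrix.vec CARD('n) (\<lambda>j. x $ from_nat_into UNIV j)"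

definition from_coords :: "real Matrix.vec \<Rightarrow> real ^ 'n" where
  "from_coords v = (\<chi> i. vec_index v (to_nat_on UNIV i))"

text \<open>Layer \<open>i\<close>, for \<open>i = 1, \<dots>, l\<close>, has weights \<open>W i\<close>, biases \<open>c i\<close> and width \<open>d i\<close>.\<close>

definition network_dims ::
  "nat \<Rightarrow> (nat \<Rightarrow> nat) \<Rightarrow> (nat \<Rightarrow> real mat) \<Rightarrow> (nat \<Rightarrow> real Matrix.vec) \<Rightarrow> bool" where
  "network_dims l d W c \<longleftrightarrow>
     (\<forall>i\<in>{1..l}. W i \<in> carrier_mat (d i) (d (i - 1)) \<and> c i \<in> carrier_vec (d i))"

primrec layer_output ::
  "(real \<Rightarrow> real) \<Rightarrow> (nat \<Rightarrow> real mat) \<Rightarrow> (nat \<Rightarrow> real Matrix.vec) \<Rightarrow>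
   nat \<Rightarrow> real Matrix.vec \<Rightarrow> real Matrix.vec" where
  "layer_output \<sigma> W c 0 z = z"
| "layer_output \<sigma> W c (Suc i) z = map_vec \<sigma> (W (Suc i) *\<^sub>v layer_output \<sigma> W c i z + c (Suc i))"

definition network ::
  "(real \<Rightarrow> real) \<Rightarrow> nat \<Rightarrow> (nat \<Rightarrow> real mat) \<Rightarrow> (nat \<Rightarrow> real Matrix.vec) \<Rightarrow>
   (real ^ 'n) \<times> (real ^ 'm) \<Rightarrow> real ^ 'n" where
  "network \<sigma> l W c p =
     from_coords
       (W l *\<^sub>v layer_output \<sigma> W c (l - 1) (list_coords (fst p) @\<^sub>v list_coords (snd p)) + c l)"


section \<open>Controlled invariance\<close>

definition controlled_invariant ::
  "('x \<times> 'u \<Rightarrow> 'x) \<Rightarrow> 'x set \<Rightarrow> 'u set \<Rightarrow> 'x set \<Rightarrow> bool" where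
  "controlled_invariant f X U S \<longleftrightarrow> S \<subseteq> X \<and> (\<forall>x\<in>S. \<exists>u\<in>U. f (x, u) \<in> S)"

definition MCIS :: "('x \<times> 'u \<Rightarrow> 'x) \<Rightarrow> 'x set \<Rightarrow> 'u set \<Rightarrow> 'x set" where
  "MCIS f X U = \<Union>{S. controlled_invariant f X U S}"


section \<open>The algorithm\<close>

text \<open>
  The algorithm is a nondeterministic transition system: the next box may be any element of the
  queue, and the partition of \<open>U\<close> and each bisection are arbitrary.  Collections of boxes are sets
  of sets, compared only through their unions.
\<close>

definition escapes ::
  "((real ^ 'n) set \<Rightarrow> (real ^ 'm) set \<Rightarrow> (real ^ 'n) set) \<Rightarrow> (real ^ 'n) set \<Rightarrow>
   nat \<Rightarrow> (nat \<Rightarrow> (real ^ 'm) set) \<Rightarrow> (real ^ 'n) set set \<Rightarrow> (real ^ 'n) set \<Rightarrow> bool" where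
  "escapes F X N us P B \<longleftrightarrow> (\<forall>i\<in>{1..N}. F B (us i) \<inter> X \<subseteq> \<Union>P)"

text \<open>A state of the inner loop consists of the queue and the collection under construction;
  \<open>P\<close> is the collection from the previous sweep.\<close>

inductive inner_step ::
  "((real ^ 'n) set \<Rightarrow> (real ^ 'm) set \<Rightarrow> (real ^ 'n) set) \<Rightarrow> (real ^ 'n) set \<Rightarrow>
   real \<Rightarrow> nat \<Rightarrow> (nat \<Rightarrow> (real ^ 'm) set) \<Rightarrow> (real ^ 'n) set set \<Rightarrow>
   (real ^ 'n) set multiset \<times> (real ^ 'n) set set \<Rightarrow>
   (real ^ 'n) set multiset \<times> (real ^ 'n) set set \<Rightarrow> bool"
  for F X \<epsilon> N us P where
  add: "escapes F X N us P B \<Longrightarrow>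
    inner_step F X \<epsilon> N us P (add_mset B Q, R) (Q, insert B R)"
| split: "\<lbrakk>\<not> escapes F X N us P B; box_width B > \<epsilon>; bisects B B1 B2\<rbrakk> \<Longrightarrow>
    inner_step F X \<epsilon> N us P (add_mset B Q, R) (add_mset B1 (add_mset B2 Q), R)"
| drop: "\<lbrakk>\<not> escapes F X N us P B; \<not> box_width B > \<epsilon>\<rbrakk> \<Longrightarrow>
    inner_step F X \<epsilon> N us P (add_mset B Q, R) (Q, R)"

definition sweep ::
  "((real ^ 'n) set \<Rightarrow> (real ^ 'm) set \<Rightarrow> (real ^ 'n) set) \<Rightarrow> (real ^ 'n) set \<Rightarrow>
   real \<Rightarrow> nat \<Rightarrow> (nat \<Rightarrow> (real ^ 'm) set) \<Rightarrow>
   (real ^ 'n) set set \<Rightarrow> (real ^ 'n) set set \<Rightarrow> bool" where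
  "sweep F X \<epsilon> N us P P' \<longleftrightarrow> (inner_step F X \<epsilon> N us P)\<^sup>*\<^sup>* ({#X#}, P) ({#}, P')"

inductive outer_iterate ::
  "((real ^ 'n) set \<Rightarrow> (real ^ 'm) set \<Rightarrow> (real ^ 'n) set) \<Rightarrow> (real ^ 'n) set \<Rightarrow>
   real \<Rightarrow> nat \<Rightarrow> (nat \<Rightarrow> (real ^ 'm) set) \<Rightarrow> nat \<Rightarrow> (real ^ 'n) set set \<Rightarrow> bool"
  for F X \<epsilon> N us where
  init: "outer_iterate F X \<epsilon> N us 0 {}"
| continue: "\<lbrakk>outer_iterate F X \<epsilon> N us k P; sweep F X \<epsilon> N us P P'; \<Union>P' \<noteq> \<Union>P\<rbrakk> \<Longrightarrow>
    outer_iterate F X \<epsilon> N us (Suc k) P'"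

definition algorithm_returns ::
  "((real ^ 'n) set \<Rightarrow> (real ^ 'm) set \<Rightarrow> (real ^ 'n) set) \<Rightarrow> (real ^ 'n) set \<Rightarrow> (real ^ 'm) set \<Rightarrow>
   real \<Rightarrow> nat \<Rightarrow> (real ^ 'n) set set \<Rightarrow> bool" where
  "algorithm_returns F X U \<epsilon> N P' \<longleftrightarrow>
     (\<exists>us k P. box_partition U N us \<and> outer_iterate F X \<epsilon> N us k P \<and>
        sweep F X \<epsilon> N us P P' \<and> \<Union>P' = \<Union>P)"

end

theory Submission
  imports Defs
begin

text \<open>
  The algorithm only ever adds a box \<open>B\<close> when, for every control slice, each successor of \<open>B\<close> that
  stays in \<open>X\<close> lies in the region already removed by the previous sweep. A state \<open>x \<in> B\<close> of a controlled
  invariant set \<open>S\<close> would have a control whose successor is again in \<open>S \<subseteq> X\<close>, hence in the removed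
  region; if that region misses \<open>S\<close>, this is impossible (\<open>escapes_disjoint_controlled_invariant\<close>).
  So disjointness from \<open>S\<close> propagates from one sweep to the next (\<open>sweep_avoids\<close>), starting from the
  empty collection, and \<open>S\<close> may be taken to be the maximal controlled invariant set because
  controlled invariance is preserved under unions (\<open>controlled_invariant_MCIS\<close>). The disjointness holds in every
  run, whatever the order in which boxes are popped and however they are bisected.
\<close>

lemma controlled_invariant_MCIS: "controlled_invariant f X U (MCIS f X U)"
  unfolding controlled_invariant_def MCIS_def by blast

lemma escapes_disjoint_controlled_invariant:
  assumes F: "inclusion_function f F" and us: "box_partition U N us"
    and S: "controlled_invariant f X U S"
    and B: "is_box B" "escapes F X N us P B"
    and P: "\<Union>P \<inter> S = {}"
  shows "B \<inter> S = {}"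
proof (rule ccontr)
  assume "B \<inter> S \<noteq> {}"
  then obtain x where x: "x \<in> B" "x \<in> S"
    by blast
  then obtain u where u: "u \<in> U" "f (x, u) \<in> S"
    using S unfolding controlled_invariant_def by blast
  then obtain i where i: "i \<in> {1..N}" "u \<in> us i" "is_box (us i)"
    using us unfolding box_partition_def by blast
  then have "f (x, u) \<in> F B (us i)"
    using F x B(1) unfolding inclusion_function_def by blast
  moreover have "f (x, u) \<in> X"
    using S u(2) unfolding controlled_invariant_def by blast
  ultimately have "f (x, u) \<in> \<Union>P"
    using B(2) i(1) unfolding escapes_def by blast
  with u(2) P show False
    by blast
qed

text \<open>
  The invariant of the inner loop must also record that the queue consists of boxes, since
  the inclusion function encloses the image of genuine boxes only, and that they lie in \<open>X\<close>, so that
  whatever is added later does too.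
\<close>

definition inner_invariant ::
  "(real ^ 'n) set \<Rightarrow> (real ^ 'n) set \<Rightarrow> (real ^ 'n) set multiset \<times> (real ^ 'n) set set \<Rightarrow> bool" where
  "inner_invariant X S s \<longleftrightarrow>
     (\<forall>B\<in>#fst s. is_box B \<and> B \<subseteq> X) \<and> \<Union>(snd s) \<subseteq> X - S"

lemma inner_step_preserves_invariant:
  assumes "inner_step F X \<epsilon> N us P s s'"
    and "inclusion_function f F" "box_partition U N us" "controlled_invariant f X U S"
    and P: "\<Union>P \<inter> S = {}"
    and "inner_invariant X S s"
  shows "inner_invariant X S s'"
  using assms(1)
proof cases
  case (add B Q R)
  then have "is_box B"
    using assms(6) by (simp add: inner_invariant_def)
  then have "B \<inter> S = {}"
    using escapes_disjoint_controlled_invariant assms(2-4) P add(3) by blast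
  with add assms(6) show ?thesis
    by (auto simp: inner_invariant_def)
next
  case (split B B1 B2 Q R)
  with assms(6) show ?thesis
    by (auto simp: inner_invariant_def bisects_def)
next
  case (drop B Q R)
  with assms(6) show ?thesis
    by (simp add: inner_invariant_def)
qed

lemma sweep_avoids:
  assumes "sweep F X \<epsilon> N us P P'" and "is_box X"
    and "inclusion_function f F" "box_partition U N us" "controlled_invariant f X U S"
    and P: "\<Union>P \<subseteq> X - S"
  shows "\<Union>P' \<subseteq> X - S"
proof -
  have "\<Union>P \<inter> S = {}"
    using P by blast
  note preserved = inner_step_preserves_invariant[OF _ assms(3-5) this]
  have "(inner_step F X \<epsilon> N us P)\<^sup>*\<^sup>* ({#X#}, P) ({#}, P')"
    using assms(1) by (simp add: sweep_def)
  then have "inner_invariant X S ({#}, P')"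
  proof (induction rule: rtranclp_induct)
    case base
    show ?case
      using assms(2) P by (simp add: inner_invariant_def)
  next
    case (step s s')
    then show ?case
      using preserved by blast
  qed
  then show ?thesis
    by (simp add: inner_invariant_def)
qed

lemma outer_iterate_avoids:
  assumes "outer_iterate F X \<epsilon> N us k P" and "is_box X"
    and "inclusion_function f F" "box_partition U N us" "controlled_invariant f X U S"
  shows "\<Union>P \<subseteq> X - S"
  using assms(1)
proof induction
  case init
  show ?case by simp
next
  case (continue k P P')
  then show ?case
    using sweep_avoids assms(2-5) by blast
qed

theorem theorem2:
  fixes X :: "(real ^ 'n) set" and U :: "(real ^ 'm) set"
    and f f0 :: "(real ^ 'n) \<times> (real ^ 'm) \<Rightarrow> real ^ 'n"
    and D :: "((real ^ 'n) \<times> (real ^ 'm)) set"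
    and \<sigma> :: "real \<Rightarrow> real" and l :: nat and d :: "nat \<Rightarrow> nat"
    and W :: "nat \<Rightarrow> real mat" and c :: "nat \<Rightarrow> real Matrix.vec"
    and F :: "(real ^ 'n) set \<Rightarrow> (real ^ 'm) set \<Rightarrow> (real ^ 'n) set"
    and \<epsilon> :: real and N\<^sub>u :: nat and \<O> :: "(real ^ 'n) set set"
  assumes "is_box X" and "is_box U"
    and "open D" and "X \<times> U \<subseteq> D" and "C2_bounded_partials_on D f0"
    and "l \<ge> 1" and "d 0 = CARD('n) + CARD('m)" and "d l = CARD('n)"
    and "network_dims l d W c"
    and "\<And>p. f p = f0 p + network \<sigma> l W c p"
    and "inclusion_function f F"
    and "\<epsilon> > 0" and "N\<^sub>u \<ge> 1"
    and "algorithm_returns F X U \<epsilon> N\<^sub>u \<O>"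
  shows "\<Union>\<O> \<subseteq> X - MCIS f X U"
proof -
  obtain us k P where run: "box_partition U N\<^sub>u us" "outer_iterate F X \<epsilon> N\<^sub>u us k P"
      "sweep F X \<epsilon> N\<^sub>u us P \<O>"
    using assms(14) unfolding algorithm_returns_def by blast
  have "\<Union>P \<subseteq> X - MCIS f X U"
    using outer_iterate_avoids[OF run(2) assms(1) assms(11) run(1) controlled_invariant_MCIS] .
  then show ?thesis
    using sweep_avoids[OF run(3) assms(1) assms(11) run(1) controlled_invariant_MCIS] by blast
qed

end
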